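(* Let $\Gamma$ be a graph and $C=\{v_1,\dots,v_7\}$ a subset of $7$ of its vertices. Let $\pi$ be the cyclic permutation $v_i\mapsto v_{i+1}$ (indices modulo $7$). Define $\ell=\{v_1,v_2,v_4\}$, $\mathcal{O}=\{v_3,v_5,v_6\}$, and $\ell_i=\pi^i(\ell)$, $\mathcal{O}_i=\pi^i(\mathcal{O})$ for $i\in\mathbb{Z}/7\mathbb{Z}$. (The set $C$ with the "lines" $\ell_i$ is the Fano plane $\mathrm{PG}(2,2)$.) Suppose that: (i) The induced subgraph on $C$ has one of the following edge sets: (a) $\{v_1v_2,\,v_2v_3,\,v_3v_4,\,v_4v_5,\,v_5v_6,\,v_6v_7,\,v_7v_1\}$; (b) $\{v_3v_4,\,v_4v_5,\,v_1v_6,\,v_3v_6,\,v_5v_6,\,v_1v_7,\,v_2v_7,\,v_3v_7,\,v_4v_7,\,v_6v_7\}$. (ii) For every vertex $v$ outside $C$, the set of neighbours of $v$ in $C$ is either $C$, or $\emptyset$, or a line $\ell_i$, or the complement $C\setminus\ell_i$ of a line. Construct $\Gamma'$ from $\Gamma$ on the same vertex set as follows, leaving all other adjacencies unchanged. For every $v$ outside $C$ whose neighbourhood in $C$ is $\ell_i$, change its neighbourhood in $C$ to $\mathcal{O}_i$; for every $v$ outside $C$ whose neighbourhood in $C$ is $C\setminus\ell_i$, change its neighbourhood in $C$ to $C\setminus\mathcal{O}_i$. In case (b), replace the induced subgraph on $C$ by the graph with edge set $$\{v_3v_4,\,v_4v_5,\,v_2v_3,\,v_2v_5,\,v_2v_7,\,v_1v_2,\,v_1v_4,\,v_1v_5,\,v_1v_6,\,v_1v_7\}.$$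 Then $\Gamma'$ is $\mathbb{R}$-cospectral with $\Gamma$.
   Context: Graphs are finite, simple and loopless. Two graphs with adjacency matrices $A$ and $A'$ are $\mathbb{R}$-cospectral if $A+rJ$ and $A'+rJ$ have the same spectrum for every $r\in\mathbb{R}$, where $J$ is the all-ones matrix. *)

theory Defs
  imports "HOL-Analysis.Analysis"
begin

text \<open>
  The vertex set of a graph is a finite type, so a graph is given by its set of edges,
  which are two-element sets of vertices.
\<close>

definition simple_graph :: "'v set set \<Rightarrow> bool" where
  "simple_graph E \<longleftrightarrow> (\<forall>e\<in>E. card e = 2)"

definition neighbours :: "'v set set \<Rightarrow> 'v \<Rightarrow> 'v set" where
  "neighbours E x = {y. {x, y} \<in> E}"

definition induced_edges :: "'v set set \<Rightarrow> 'v set \<Rightarrow> 'v set set" where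
  "induced_edges E C = {e \<in> E. e \<subseteq> C}"

definition adjacency_matrix :: "'v::finite set set \<Rightarrow> real^'v^'v" where
  "adjacency_matrix E = (\<chi> x y. if {x, y} \<in> E then 1 else 0)"

definition all_ones :: "real^'v^'v" where
  "all_ones = (\<chi> x y. 1)"

definition charpoly :: "'a::comm_ring_1^'n^'n \<Rightarrow> 'a poly" where
  "charpoly M = det (mat [:0, 1:] - (\<chi> i j. [:M $ i $ j:]))"

text \<open>The spectrum is the multiset of complex eigenvalues with algebraic multiplicities.\<close>

definition spectrum :: "real^'n^'n \<Rightarrow> complex multiset" where
  "spectrum M = proots (map_poly complex_of_real (charpoly M))"

definition real_cospectral :: "'v::finite set set \<Rightarrow> 'w::finite set set \<Rightarrow> bool" where
  "real_cospectral E F \<longleftrightarrow>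
     (\<forall>r::real. spectrum (adjacency_matrix E + r *\<^sub>R all_ones) =
                spectrum (adjacency_matrix F + r *\<^sub>R all_ones))"

text \<open>
  The seven distinguished vertices are given by a map \<open>v\<close> on the type \<open>7\<close>, which is the ring
  of integers modulo 7; thus \<open>v 7\<close> is \<open>v 0\<close>, and the cyclic permutation \<open>\<pi>\<close> sends \<open>v j\<close>
  to \<open>v (j + 1)\<close>. The next two definitions are the images under the \<open>i\<close>-th power of \<open>\<pi>\<close> of
  \<open>{v 1, v 2, v 4}\<close> and of \<open>{v 3, v 5, v 6}\<close>.
\<close>

definition line :: "(7 \<Rightarrow> 'v) \<Rightarrow> 7 \<Rightarrow> 'v set" where
  "line v i = (\<lambda>j. v (j + i)) ` {1, 2, 4}"

definition oval :: "(7 \<Rightarrow> 'v) \<Rightarrow> 7 \<Rightarrow> 'v set" where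
  "oval v i = (\<lambda>j. v (j + i)) ` {3, 5, 6}"

definition edges_a :: "(7 \<Rightarrow> 'v) \<Rightarrow> 'v set set" where
  "edges_a v = {{v 1, v 2}, {v 2, v 3}, {v 3, v 4}, {v 4, v 5}, {v 5, v 6}, {v 6, v 7}, {v 7, v 1}}"

definition edges_b :: "(7 \<Rightarrow> 'v) \<Rightarrow> 'v set set" where
  "edges_b v = {{v 3, v 4}, {v 4, v 5}, {v 1, v 6}, {v 3, v 6}, {v 5, v 6},
                {v 1, v 7}, {v 2, v 7}, {v 3, v 7}, {v 4, v 7}, {v 6, v 7}}"

definition edges_b_new :: "(7 \<Rightarrow> 'v) \<Rightarrow> 'v set set" where
  "edges_b_new v = {{v 3, v 4}, {v 4, v 5}, {v 2, v 3}, {v 2, v 5}, {v 2, v 7},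
                    {v 1, v 2}, {v 1, v 4}, {v 1, v 5}, {v 1, v 6}, {v 1, v 7}}"

text \<open>
  For injective \<open>v\<close> the index \<open>i\<close> below is unique, and no line is the complement of a line.
\<close>

definition switched_neighbourhood :: "(7 \<Rightarrow> 'v) \<Rightarrow> 'v set \<Rightarrow> 'v set" where
  "switched_neighbourhood v N =
     (if \<exists>i. N = line v i then oval v (THE i. N = line v i)
      else if \<exists>i. N = range v - line v i then range v - oval v (THE i. N = range v - line v i)
      else N)"

definition switched_graph :: "'v set set \<Rightarrow> (7 \<Rightarrow> 'v) \<Rightarrow> 'v set set" where
  "switched_graph E v =
     induced_edges E (- range v) \<union>
     {{x, y} | x y. x \<notin> range v \<and> y \<in> switched_neighbourhood v (neighbours E x \<inter> range v)} \<union>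
     (if induced_edges E (range v) = edges_b v then edges_b_new v else induced_edges E (range v))"

lemma simple_graph_switched_graph:
  assumes "simple_graph E" and "inj v"
  shows "simple_graph (switched_graph E v)"
proof -
  have "switched_neighbourhood v (neighbours E x \<inter> range v) \<subseteq> range v" for x
    by (auto simp: switched_neighbourhood_def line_def oval_def)
  then have mixed: "card {x, y} = 2"
    if "x \<notin> range v" "y \<in> switched_neighbourhood v (neighbours E x \<inter> range v)" for x y
    using that by (metis card_2_iff subsetD)
  have "v i = v j \<longleftrightarrow> i = j" for i j
    using assms(2) by (auto dest: injD)
  then have "\<forall>e\<in>edges_b_new v. card e = 2"
    by (simp add: edges_b_new_def card_insert_if)
  with mixed assms(1) show ?thesis
    unfolding simple_graph_def switched_graph_def induced_edges_def by auto
qed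

end

theory Submission
  imports Defs
begin

text \<open>
  Let \<open>S\<close> be the cyclic shift on the seven coordinates in \<open>C\<close> and \<open>N = S + S\<^sup>2 + S\<^sup>4\<close> the incidence
  matrix of the Fano plane. Since \<open>N N\<^sup>T = 2 I + J\<close> and \<open>N\<^sup>2 = N + 2 N\<^sup>T\<close>, the circulant
  \<open>(N - I) / 2\<close> is orthogonal, has row and column sums 1, and maps \<open>N\<close> to \<open>N\<^sup>T\<close>, that is, lines to
  ovals. Extended by the identity outside \<open>C\<close> it gives an orthogonal matrix that commutes with the
  all-ones matrix. It intertwines the two adjacency matrices: inside \<open>C\<close> because in case (a) both are
  the same circulant, and in case (b) by inspection.
\<close>

section \<open>Exhaustion over the integers modulo 7, and the weights\<close>

lemma exhaust_7:
  fixes i :: 7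
  shows "i = 0 \<or> i = 1 \<or> i = 2 \<or> i = 3 \<or> i = 4 \<or> i = 5 \<or> i = 6"
proof (induct i)
  case (of_int z)
  then have "z = 0 \<or> z = 1 \<or> z = 2 \<or> z = 3 \<or> z = 4 \<or> z = 5 \<or> z = 6"
    by fastforce
  then show ?case
    by auto
qed

lemma forall_7: "(\<forall>i::7. P i) \<longleftrightarrow> P 0 \<and> P 1 \<and> P 2 \<and> P 3 \<and> P 4 \<and> P 5 \<and> P 6"
  by (metis exhaust_7)

lemma UNIV_7: "(UNIV :: 7 set) = {0, 1, 2, 3, 4, 5, 6}"
  using exhaust_7 by auto

lemma sum_7: "sum f (UNIV :: 7 set) = f 0 + f 1 + f 2 + f 3 + f 4 + f 5 + f 6"
  unfolding UNIV_7 by (simp add: ac_simps)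

text \<open>The circulant of the overview as a function of the difference of the indices: its entry
  at (i, j) is the weight of \<open>j - i\<close>. The set {1, 2, 4} consists of the nonzero squares
  modulo 7.\<close>

definition fano_weight :: "7 \<Rightarrow> real" where
  "fano_weight d = (if d = 0 then - (1 / 2) else if d \<in> {1, 2, 4} then 1 / 2 else 0)"

section \<open>Similarity and cospectrality\<close>

lemma charpoly_eq_if_intertwined:
  fixes M N P R :: "'a::comm_ring_1^'n^'n"
  assumes "M ** P = P ** N" and "P ** R = mat 1"
  shows "charpoly M = charpoly N"
proof -
  \<comment> \<open>Matrices over the ring become matrices of constant polynomials. \<open>C\<close>
    is multiplicative and \<open>Z\<close> is a scalar matrix, so the intertwining relation carries
    over to the characteristic matrices \<open>Z - C M\<close> and \<open>Z - C N\<close>.\<close>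
  define C :: "'a^'n^'n \<Rightarrow> 'a poly^'n^'n" where "C X = (\<chi> i j. [:X $ i $ j:])" for X
  define Z :: "'a poly^'n^'n" where "Z = mat [:0, 1:]"
  have C_mult: "C (X ** Y) = C X ** C Y" for X Y
    by (simp add: C_def vec_eq_iff matrix_matrix_mult_def mult_ac flip: sum_to_poly)
  have Z_commute: "Z ** C X = C X ** Z" for X
    by (simp add: Z_def C_def vec_eq_iff matrix_matrix_mult_def mat_def if_distrib if_distribR
        cong: if_cong)
  have "(Z - C M) ** C P = Z ** C P - C (M ** P)"
    unfolding C_mult by (simp add: vec_eq_iff matrix_matrix_mult_def sum_subtractf left_diff_distrib)
  also have "\<dots> = C P ** (Z - C N)"
    unfolding assms(1) Z_commute C_mult
    by (simp add: vec_eq_iff matrix_matrix_mult_def sum_subtractf right_diff_distrib)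
  finally have eq: "det (Z - C M) * det (C P) = det (C P) * det (Z - C N)"
    by (metis det_mul)
  have "C (mat 1) = mat 1"
    by (simp add: C_def vec_eq_iff mat_def one_pCons)
  then have unit: "det (C P) * det (C R) = 1"
    using assms(2) by (metis C_mult det_I det_mul)
  \<comment> \<open>The ring may have zero divisors, so \<open>det (C P)\<close> is removed by
    multiplying with its inverse \<open>det (C R)\<close>.\<close>
  have "det (Z - C M) = det (Z - C M) * det (C P) * det (C R)"
    by (simp add: unit mult.assoc)
  also have "\<dots> = det (Z - C N) * (det (C P) * det (C R))"
    unfolding eq by (simp add: mult_ac)
  finally have "det (Z - C M) = det (Z - C N)"
    by (simp add: unit)
  then show ?thesis
    by (simp add: charpoly_def Z_def C_def)
qed

lemma add_matrix_mult: "(A + B) ** C = A ** C + B ** C"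
  by (simp add: vec_eq_iff matrix_matrix_mult_def sum.distrib distrib_right)

text \<open>\<open>Q\<close> does not depend on \<open>r\<close>, so one similarity serves the whole
  pencil.\<close>

lemma real_cospectral_if_intertwined:
  fixes Q R :: "real^'v^'v::finite"
  assumes "adjacency_matrix E ** Q = Q ** adjacency_matrix F"
    and "all_ones ** Q = Q ** all_ones"
    and "Q ** R = mat 1"
  shows "real_cospectral E F"
  unfolding real_cospectral_def spectrum_def
proof
  fix r :: real
  have "(r *\<^sub>R all_ones) ** Q = Q ** (r *\<^sub>R all_ones)"
    by (metis assms(2) matrix_scalar_ac scalar_matrix_assoc)
  then have "(adjacency_matrix E + r *\<^sub>R all_ones) ** Q = Q ** (adjacency_matrix F + r *\<^sub>R all_ones)"
    using assms(1) by (simp add: matrix_add_ldistrib add_matrix_mult)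
  from charpoly_eq_if_intertwined[OF this assms(3)]
  show "proots (map_poly complex_of_real (charpoly (adjacency_matrix E + r *\<^sub>R all_ones))) =
        proots (map_poly complex_of_real (charpoly (adjacency_matrix F + r *\<^sub>R all_ones)))"
    by simp
qed

section \<open>Identities for the weights on the integers modulo 7\<close>

text \<open>For \<open>i = j\<close> four terms 1/4 add up. Otherwise the translates of {1, 2, 4} by
  \<open>i\<close> and \<open>j\<close> share one point, giving 1/4, and exactly one of
  \<open>i - j\<close> and \<open>j - i\<close> is a square, giving -1/4.\<close>

lemma sum_fano_weight_mult:
  "(\<Sum>k\<in>UNIV. fano_weight (k - i) * fano_weight (k - j)) = of_bool (i = j)"
proof -
  have "\<forall>i j. (\<Sum>k\<in>UNIV. fano_weight (k - i) * fano_weight (k - j)) = of_bool (i = j)"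
    by (simp add: forall_7 sum_7 fano_weight_def)
  then show ?thesis
    by blast
qed

lemma sum_fano_weight:
  shows "(\<Sum>k\<in>UNIV. fano_weight (j - k)) = 1" and "(\<Sum>k\<in>UNIV. fano_weight (k - i)) = 1"
proof -
  have "\<forall>j. (\<Sum>k\<in>UNIV. fano_weight (j - k)) = 1" "\<forall>i. (\<Sum>k\<in>UNIV. fano_weight (k - i)) = 1"
    by (simp_all add: forall_7 sum_7 fano_weight_def)
  then show "(\<Sum>k\<in>UNIV. fano_weight (j - k)) = 1" "(\<Sum>k\<in>UNIV. fano_weight (k - i)) = 1"
    by blast+
qed

text \<open>Modulo x^7 - 1, (x + x^2 + x^4)(x + x^2 + x^4 - 1) = 2(x^3 + x^5 + x^6).\<close>

lemma sum_fano_weight_line: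
  "(\<Sum>k\<in>UNIV. of_bool (k \<in> line id i) * fano_weight (j - k)) = of_bool (j \<in> oval id i)"
proof -
  have "\<forall>i j. (\<Sum>k\<in>UNIV. of_bool (k \<in> line id i) * fano_weight (j - k)) = of_bool (j \<in> oval id i)"
    by (simp add: forall_7 sum_7 fano_weight_def line_def oval_def)
  then show ?thesis
    by blast
qed

lemma neighbours_edges_a:
  "neighbours (edges_a id) i = {i - 1, i + 1}"
proof -
  have "\<forall>i. neighbours (edges_a id) i = {i - 1, i + 1}"
    unfolding set_eq_iff forall_7
    by (simp add: neighbours_def edges_a_def doubleton_eq_iff)
  then show ?thesis
    by blast
qed

text \<open>Index 0 stands for the vertex v_7, because 7 = 0 in the type \<open>7\<close>.\<close>

lemma neighbours_edges_b:
  "neighbours (edges_b id) 0 = {1, 2, 3, 4, 6}"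
  "neighbours (edges_b id) 1 = {0, 6}"
  "neighbours (edges_b id) 2 = {0}"
  "neighbours (edges_b id) 3 = {0, 4, 6}"
  "neighbours (edges_b id) 4 = {0, 3, 5}"
  "neighbours (edges_b id) 5 = {4, 6}"
  "neighbours (edges_b id) 6 = {0, 1, 3, 5}"
  unfolding set_eq_iff forall_7
  by (simp_all add: neighbours_def edges_b_def doubleton_eq_iff)

lemma neighbours_edges_b_new:
  "neighbours (edges_b_new id) 0 = {1, 2}"
  "neighbours (edges_b_new id) 1 = {0, 2, 4, 5, 6}"
  "neighbours (edges_b_new id) 2 = {0, 1, 3, 5}"
  "neighbours (edges_b_new id) 3 = {2, 4}"
  "neighbours (edges_b_new id) 4 = {1, 3, 5}"
  "neighbours (edges_b_new id) 5 = {1, 2, 4}"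
  "neighbours (edges_b_new id) 6 = {1}"
  unfolding set_eq_iff forall_7
  by (simp_all add: neighbours_def edges_b_new_def doubleton_eq_iff)

lemma
  fixes f :: "'a::finite \<Rightarrow> real"
  shows sum_edge_mult: "(\<Sum>k\<in>UNIV. of_bool ({i, k} \<in> X) * f k) = sum f (neighbours X i)"
    and sum_mult_edge: "(\<Sum>k\<in>UNIV. f k * of_bool ({k, i} \<in> X)) = sum f (neighbours X i)"
  by (simp_all add: neighbours_def of_bool_def if_distrib if_distribR sum.If_cases
      insert_commute[of _ i] cong: if_cong)

lemma sum_fano_weight_edges_a:
  "(\<Sum>k\<in>UNIV. of_bool ({i, k} \<in> edges_a id) * fano_weight (j - k)) =
   (\<Sum>k\<in>UNIV. fano_weight (k - i) * of_bool ({k, j} \<in> edges_a id))"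
proof -
  \<comment> \<open>Distinctness makes the sum over the two neighbours split into two terms; both
    sides then consist of the weights of \<open>j - i + 1\<close> and
    \<open>j - i - 1\<close>.\<close>
  have "l - 1 \<noteq> l + 1" for l :: 7
    by (simp add: algebra_simps)
  then show ?thesis
    unfolding sum_edge_mult sum_mult_edge neighbours_edges_a by (simp add: algebra_simps)
qed

text \<open>These two graphs are not regular, so their matrices are not circulants, and all 49
  entries are checked.\<close>

lemma sum_fano_weight_edges_b:
  "(\<Sum>k\<in>UNIV. of_bool ({i, k} \<in> edges_b id) * fano_weight (j - k)) =
   (\<Sum>k\<in>UNIV. fano_weight (k - i) * of_bool ({k, j} \<in> edges_b_new id))"
proof -
  have "\<forall>i j. (\<Sum>k\<in>neighbours (edges_b id) i. fano_weight (j - k)) =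
      (\<Sum>k\<in>neighbours (edges_b_new id) j. fano_weight (k - i))"
    by (simp add: forall_7 neighbours_edges_b neighbours_edges_b_new fano_weight_def)
  then show ?thesis
    unfolding sum_edge_mult sum_mult_edge by blast
qed

section \<open>Lines, their complements and switched neighbourhoods\<close>

lemma line_eq_image: "line v i = v ` line id i" and oval_eq_image: "oval v i = v ` oval id i"
  by (auto simp: line_def oval_def)

text \<open>This makes the definite descriptions in \<open>switched_neighbourhood\<close> well
  defined.\<close>

lemma line_inject:
  assumes "inj v"
  shows "line v i = line v j \<longleftrightarrow> i = j"
proof -
  have "\<forall>i j. line id i = line id j \<longrightarrow> i = j"
    unfolding set_eq_iff forall_7 by (simp add: line_def)
  then show ?thesis
    using assms by (metis inj_image_eq_iff line_eq_image)
qed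

text \<open>The sizes 3 and 4 separate lines and their complements from each other and from the
  sizes 0 and 7 of the trivial neighbourhoods.\<close>

lemma card_line:
  assumes "inj v"
  shows "card (line v i) = 3" and "card (range v - line v i) = 4"
proof -
  have "inj (\<lambda>j. v (j + i))"
    using assms by (meson add_right_cancel injD injI)
  then have "card (line v i) = card {1, 2, 4 :: 7}"
    unfolding line_def by (metis card_image inj_on_subset subset_UNIV)
  then show *: "card (line v i) = 3"
    by simp
  have "card (range v) = 7"
    using assms by (simp add: card_image)
  moreover have "line v i \<subseteq> range v"
    by (auto simp: line_def)
  ultimately show "card (range v - line v i) = 4"
    using * by (simp add: card_Diff_subset finite_subset)
qed

lemma switched_neighbourhood_line:
  assumes "inj v"
  shows "switched_neighbourhood v (line v i) = oval v i"
  unfolding switched_neighbourhood_def line_inject[OF assms] by auto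

lemma switched_neighbourhood_compl:
  assumes "inj v"
  shows "switched_neighbourhood v (range v - line v i) = range v - oval v i"
proof -
  have "card (range v - line v i) \<noteq> card (line v j)" for j
    unfolding card_line[OF assms] by simp
  then have "range v - line v i \<noteq> line v j" for j
    by metis
  \<comment> \<open>Complementation within \<open>range v\<close> is an involution on its subsets,
    so equal complements come from equal lines.\<close>
  moreover have "line v j = range v - (range v - line v j)" for j
    by (auto simp: line_def)
  then have "range v - line v i = range v - line v j \<longleftrightarrow> i = j" for j
    using line_inject[OF assms] by metis
  ultimately show ?thesis
    unfolding switched_neighbourhood_def by simp
qed

lemma switched_neighbourhood_trivial:
  assumes "inj v" and "card N \<noteq> 3" and "card N \<noteq> 4"
  shows "switched_neighbourhood v N = N"
proof -
  have "N \<noteq> line v j" "N \<noteq> range v - line v j" for j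
    using assms(2,3) card_line[OF assms(1)] by metis+
  then show ?thesis
    unfolding switched_neighbourhood_def by simp
qed

text \<open>Switching is linear on indicator vectors: the empty set and \<open>C\<close> are fixed,
  the latter because the weights sum to 1, lines go to ovals, and complements follow by
  subtraction.\<close>

lemma sum_fano_weight_switched:
  assumes "inj v"
    and "N = range v \<or> N = {} \<or> (\<exists>i. N = line v i) \<or> (\<exists>i. N = range v - line v i)"
  shows "(\<Sum>k\<in>UNIV. of_bool (v k \<in> N) * fano_weight (j - k)) = of_bool (v j \<in> switched_neighbourhood v N)"
proof -
  have mem: "v k \<in> line v i \<longleftrightarrow> k \<in> line id i" "v k \<in> oval v i \<longleftrightarrow> k \<in> oval id i" for k i
    using assms(1) by (metis inj_image_mem_iff line_eq_image, metis inj_image_mem_iff oval_eq_image)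
  from assms(2) consider "N = range v" | "N = {}" | i where "N = line v i"
    | i where "N = range v - line v i"
    by blast
  then show ?thesis
  proof cases
    case 1
    then show ?thesis
      using assms(1) by (simp add: switched_neighbourhood_trivial card_image sum_fano_weight)
  next
    case 2
    then show ?thesis
      using assms(1) by (simp add: switched_neighbourhood_trivial)
  next
    case (3 i)
    then show ?thesis
      using assms(1) by (simp add: switched_neighbourhood_line mem sum_fano_weight_line)
  next
    case (4 i)
    then show ?thesis
      using assms(1) sum_fano_weight(1)[of j] sum_fano_weight_line[of i j]
      by (simp add: switched_neighbourhood_compl mem of_bool_not_iff left_diff_distrib sum_subtractf)
  qed
qed

section \<open>The orthogonal matrix on the whole vertex set\<close>

definition fano_matrix :: "(7 \<Rightarrow> 'v::finite) \<Rightarrow> real^'v^'v" where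
  "fano_matrix v = (\<chi> x y. if x \<in> range v \<and> y \<in> range v then fano_weight (inv v y - inv v x)
                             else of_bool (x = y))"

lemma fano_matrix_nth_range:
  assumes "inj v"
  shows "fano_matrix v $ v i $ v j = fano_weight (j - i)"
  using assms by (simp add: fano_matrix_def)

lemma fano_matrix_nth_outside:
  assumes "x \<notin> range v \<or> y \<notin> range v"
  shows "fano_matrix v $ x $ y = of_bool (x = y)"
  using assms by (auto simp: fano_matrix_def)

lemma sum_range_eq:
  assumes "inj v" and "\<And>x. x \<notin> range v \<Longrightarrow> f x = 0"
  shows "sum f (UNIV :: 'v::finite set) = (\<Sum>k\<in>(UNIV :: 7 set). f (v k))"
proof -
  have "sum f UNIV = sum f (range v)"
    using assms(2) by (intro sum.mono_neutral_right) auto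
  then show ?thesis
    using assms(1) by (simp add: sum.reindex)
qed

text \<open>The matrix is block diagonal for \<open>C\<close> and its complement, so a product with
  it only sums over \<open>C\<close> here.\<close>

lemma
  assumes "inj v"
  shows matrix_mult_fano_nth_range:
      "(M ** fano_matrix v) $ x $ v j = (\<Sum>k\<in>UNIV. M $ x $ v k * fano_weight (j - k))"
    and fano_mult_matrix_nth_range:
      "(fano_matrix v ** M) $ v i $ y = (\<Sum>k\<in>UNIV. fano_weight (k - i) * M $ v k $ y)"
proof -
  have "fano_matrix v $ x $ v j = 0" "fano_matrix v $ v i $ x = 0" if "x \<notin> range v" for x
    using that by (auto simp: fano_matrix_def)
  then show "(M ** fano_matrix v) $ x $ v j = (\<Sum>k\<in>UNIV. M $ x $ v k * fano_weight (j - k))"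
    and "(fano_matrix v ** M) $ v i $ y = (\<Sum>k\<in>UNIV. fano_weight (k - i) * M $ v k $ y)"
    using assms by (simp_all add: matrix_matrix_mult_def sum_range_eq fano_matrix_def)
qed

lemma
  assumes "y \<notin> range v"
  shows matrix_mult_fano_nth_outside: "(M ** fano_matrix v) $ x $ y = M $ x $ y"
    and fano_mult_matrix_nth_outside: "(fano_matrix v ** M) $ y $ x = M $ y $ x"
  using assms by (simp_all add: matrix_matrix_mult_def fano_matrix_def)

text \<open>The condition on the edges between \<open>C\<close> and its complement gives both halves of the
  intertwining relation there, because the weights are orthogonal.\<close>

lemma fano_matrix_intertwines:
  assumes "inj v" and "\<And>x y. M $ x $ y = M $ y $ x" and "\<And>x y. N $ x $ y = N $ y $ x"
    and outside: "\<And>x y. x \<notin> range v \<Longrightarrow> y \<notin> range v \<Longrightarrow> M $ x $ y = N $ x $ y"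
    and mixed: "\<And>x j. x \<notin> range v \<Longrightarrow> (\<Sum>k\<in>UNIV. M $ x $ v k * fano_weight (j - k)) = N $ x $ v j"
    and inside: "\<And>i j. (\<Sum>k\<in>UNIV. M $ v i $ v k * fano_weight (j - k)) =
                        (\<Sum>k\<in>UNIV. fano_weight (k - i) * N $ v k $ v j)"
  shows "M ** fano_matrix v = fano_matrix v ** N"
proof -
  have mixed': "(\<Sum>k\<in>UNIV. fano_weight (k - i) * N $ v k $ y) = M $ v i $ y" if "y \<notin> range v" for i y
  proof -
    \<comment> \<open>By symmetry \<open>N $ v k $ y\<close> equals \<open>N $ y $ v k\<close>,
      which \<open>mixed\<close> expands into entries of \<open>M\<close>.\<close>
    have "(\<Sum>k\<in>UNIV. fano_weight (k - i) * N $ v k $ y) =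
        (\<Sum>k\<in>UNIV. \<Sum>l\<in>UNIV. M $ y $ v l * (fano_weight (k - i) * fano_weight (k - l)))"
      using mixed[OF that] assms(3)[of _ y] by (simp add: sum_distrib_left mult_ac flip: mixed[OF that])
    also have "\<dots> = (\<Sum>l\<in>UNIV. M $ y $ v l * of_bool (i = l))"
      by (subst sum.swap) (simp add: sum_fano_weight_mult flip: sum_distrib_left)
    also have "\<dots> = M $ v i $ y"
      by (simp add: assms(2)[of y])
    finally show ?thesis .
  qed
  have "(M ** fano_matrix v) $ x $ y = (fano_matrix v ** N) $ x $ y" for x y
  proof (cases "x \<in> range v"; cases "y \<in> range v")
  qed (use assms(1) outside mixed mixed' inside in
      \<open>auto simp: matrix_mult_fano_nth_range fano_mult_matrix_nth_range
        matrix_mult_fano_nth_outside fano_mult_matrix_nth_outside\<close>)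
  then show ?thesis
    by (simp add: vec_eq_iff)
qed

lemma fano_matrix_orthogonal:
  assumes "inj v"
  shows "fano_matrix v ** transpose (fano_matrix v) = mat 1"
proof -
  have "(fano_matrix v ** transpose (fano_matrix v)) $ x $ y = mat 1 $ x $ y" for x y
  proof (cases "x \<in> range v")
    case True
    then obtain i where x: "x = v i"
      by blast
    show ?thesis
    proof (cases "y \<in> range v")
      case True
      then obtain j where y: "y = v j"
        by blast
      show ?thesis
        unfolding x y fano_mult_matrix_nth_range[OF assms]
        using assms by (simp add: transpose_def fano_matrix_nth_range sum_fano_weight_mult mat_def inj_eq)
    next
      case False
      then have "y \<noteq> v k" for k
        by blast
      with False show ?thesis
        unfolding x fano_mult_matrix_nth_range[OF assms]
        by (auto simp: transpose_def fano_matrix_nth_outside mat_def)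
    qed
  next
    case False
    then show ?thesis
      by (auto simp: fano_mult_matrix_nth_outside transpose_def fano_matrix_nth_outside mat_def)
  qed
  then show ?thesis
    by (simp add: vec_eq_iff)
qed

section \<open>Adjacency in the switched graph\<close>

lemma
  assumes "inj v"
  shows mem_edges_a: "{v i, v j} \<in> edges_a v \<longleftrightarrow> {i, j} \<in> edges_a id"
    and mem_edges_b: "{v i, v j} \<in> edges_b v \<longleftrightarrow> {i, j} \<in> edges_b id"
    and mem_edges_b_new: "{v i, v j} \<in> edges_b_new v \<longleftrightarrow> {i, j} \<in> edges_b_new id"
  using assms by (simp_all only: edges_a_def edges_b_def edges_b_new_def insert_iff empty_iff
      doubleton_eq_iff inj_eq id_apply)

lemma switched_neighbourhood_subset: "N \<subseteq> range v \<Longrightarrow> switched_neighbourhood v N \<subseteq> range v"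
  by (auto simp: switched_neighbourhood_def line_def oval_def)

lemma
  shows switched_graph_outside:
      "x \<notin> range v \<Longrightarrow> y \<notin> range v \<Longrightarrow> {x, y} \<in> switched_graph E v \<longleftrightarrow> {x, y} \<in> E"
    and switched_graph_mixed:
      "x \<notin> range v \<Longrightarrow> {x, v j} \<in> switched_graph E v \<longleftrightarrow>
         v j \<in> switched_neighbourhood v (neighbours E x \<inter> range v)"
    and switched_graph_inside:
      "{v i, v j} \<in> switched_graph E v \<longleftrightarrow>
         {v i, v j} \<in> (if induced_edges E (range v) = edges_b v then edges_b_new v
                       else induced_edges E (range v))"
proof -
  \<comment> \<open>\<open>S\<close> and \<open>I\<close> keep the pieces of the union apart: an
    edge of the second piece has exactly one end in \<open>C\<close>, and an edge of the third has
    both.\<close>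
  have S: "switched_neighbourhood v (neighbours E x \<inter> range v) \<subseteq> range v" for x
    by (rule switched_neighbourhood_subset) simp
  have I: "\<Union> (if induced_edges E (range v) = edges_b v then edges_b_new v
              else induced_edges E (range v)) \<subseteq> range v"
    by (auto simp: induced_edges_def edges_b_new_def)
  have pair: "{p, q} \<in> {{x, y} | x y. x \<notin> range v \<and> y \<in> T x} \<longleftrightarrow>
      p \<notin> range v \<and> q \<in> T p \<or> q \<notin> range v \<and> p \<in> T q" for p q T
    unfolding mem_Collect_eq doubleton_eq_iff by metis
  have induced: "{p, q} \<in> induced_edges E (- range v) \<longleftrightarrow> {p, q} \<in> E \<and> p \<notin> range v \<and> q \<notin> range v" for p q
    by (simp add: induced_edges_def)
  show "{x, y} \<in> switched_graph E v \<longleftrightarrow> {x, y} \<in> E" if "x \<notin> range v" "y \<notin> range v"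
    unfolding switched_graph_def Un_iff pair induced using that S I by blast
  show "{x, v j} \<in> switched_graph E v \<longleftrightarrow>
      v j \<in> switched_neighbourhood v (neighbours E x \<inter> range v)" if "x \<notin> range v"
    unfolding switched_graph_def Un_iff pair induced using that S I by blast
  show "{v i, v j} \<in> switched_graph E v \<longleftrightarrow>
      {v i, v j} \<in> (if induced_edges E (range v) = edges_b v then edges_b_new v
                    else induced_edges E (range v))"
    unfolding switched_graph_def Un_iff pair induced by blast
qed

lemma adjacency_matrix_nth: "adjacency_matrix E $ x $ y = of_bool ({x, y} \<in> E)"
  by (simp add: adjacency_matrix_def)

lemma all_ones_nth: "all_ones $ x $ y = 1"
  by (simp add: all_ones_def)

theorem theorem25:
  fixes E :: "'v::finite set set" and v :: "7 \<Rightarrow> 'v"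
  assumes "simple_graph E"
    and "inj v"
    and "induced_edges E (range v) = edges_a v \<or> induced_edges E (range v) = edges_b v"
    and "\<And>x. x \<notin> range v \<Longrightarrow>
           neighbours E x \<inter> range v = range v \<or>
           neighbours E x \<inter> range v = {} \<or>
           (\<exists>i. neighbours E x \<inter> range v = line v i) \<or>
           (\<exists>i. neighbours E x \<inter> range v = range v - line v i)"
  shows "real_cospectral (switched_graph E v) E"
proof -
  let ?F = "switched_graph E v"
  have mixed: "(\<Sum>k\<in>UNIV. of_bool ({x, v k} \<in> E) * fano_weight (j - k)) = of_bool ({x, v j} \<in> ?F)"
    if "x \<notin> range v" for x j
    using sum_fano_weight_switched[OF assms(2) assms(4)[OF that], of j] switched_graph_mixed[OF that]
    by (simp add: neighbours_def)
  have E_inside: "{v i, v j} \<in> E \<longleftrightarrow> {v i, v j} \<in> induced_edges E (range v)" for i j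
    by (simp add: induced_edges_def)
  have inside: "(\<Sum>k\<in>UNIV. of_bool ({v i, v k} \<in> E) * fano_weight (j - k)) =
      (\<Sum>k\<in>UNIV. fano_weight (k - i) * of_bool ({v k, v j} \<in> ?F))" for i j
  proof (cases "induced_edges E (range v) = edges_b v")
    case True
    then show ?thesis
      using assms(2) sum_fano_weight_edges_b[of i j]
      by (simp add: E_inside switched_graph_inside mem_edges_b mem_edges_b_new)
  \<comment> \<open>Here case (a) holds, and switching keeps the edges inside
    \<open>C\<close>.\<close>
  next
    case False
    then show ?thesis
      using assms(2,3) sum_fano_weight_edges_a[of i j]
      by (simp add: E_inside switched_graph_inside mem_edges_a)
  qed
  have "adjacency_matrix E ** fano_matrix v = fano_matrix v ** adjacency_matrix ?F"
    using assms(2) mixed inside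
    by (intro fano_matrix_intertwines)
      (simp_all add: adjacency_matrix_nth insert_commute switched_graph_outside)
  \<comment> \<open>With the all-ones matrix on both sides, the hypotheses reduce to the row and
    column sums being 1.\<close>
  moreover have "all_ones ** fano_matrix v = fano_matrix v ** all_ones"
    using assms(2) by (intro fano_matrix_intertwines) (simp_all add: all_ones_nth sum_fano_weight)
  ultimately have "real_cospectral E ?F"
    using fano_matrix_orthogonal[OF assms(2)] by (rule real_cospectral_if_intertwined)
  then show ?thesis
    by (simp add: real_cospectral_def)
qed

end
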